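(* Let $\Phi$ be a field of characteristic $3$ and let $(J,M)$ be a $J$-ternary algebra over $\Phi$. Then $\operatorname{InDer}_J(M)\oplus M$, with even part $\operatorname{InDer}_J(M)$, odd part $M$, and operation $$[(c,m),(d,n)]=([c,d]+L_{m,n}+L_{n,m},\;c(n)-d(m)),$$ forms an operadic Lie superalgebra.
   Context: A $J$-ternary algebra is a module $M$ with a trilinear product $(x,y,z)\mapsto xyz$ such that $$xy(uvw)-uv(xyw)=(xyu)vw+u(yxv)w,\qquad xyz-zyx=zxy-xzy$$ for all $x,y,z,u,v,w\in M$. Put $L_{x,y}z=xyz$ and $\langle x,y\rangle z=yzx-xzy$. $J$ is the linear span of the endomorphisms $\langle x,y\rangle$ of $M$; it is a Jordan subalgebra of $\operatorname{End}(M)$ under $a\cdot b=(ab+ba)/2$, and it is assumed throughout to be unital, with unit $1$. $\operatorname{InStr}(M)$ is the linear span of all $L_{x,y}$ in $\operatorname{End}(M)$; it is a Lie algebra acting on $M$, and on $J$ by $s\cdot\langle a,b\rangle=\langle s a,b\rangle+\langle a,s b\rangle$. $\operatorname{InDer}_J(M)=\{d\in\operatorname{InStr}(M): d\cdot 1=0\}$. An operadic Lie algebra in a braided tensor category with braiding $b$ is an object $L$ with a morphism $[\cdot,\cdot]:L\otimes L\to L$ such that $[\cdot,\cdot]+[\cdot,\cdot]\circ b_{L,L}=0$ and $[\cdot,[\cdot,\cdot]]\circ(\mathrm{Id}+(b_{L,L}\otimes 1)(1\otimes b_{L,L})+(1\otimes b_{L,L})(b_{L,L}\otimes 1))=0$.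 An operadic Lie superalgebra is an operadic Lie algebra in the category of super vector spaces over $\Phi$ (braiding $a\otimes b\mapsto(-1)^{|a||b|}b\otimes a$). So the condition $[x,[x,x]]=0$ for odd $x$ is not included. *)

theory Defs
  imports Complex_Main "HOL-Library.Function_Algebras" "HOL-Library.Product_Plus" "HOL-Library.Z2"
begin

section \<open>Operadic Lie superalgebras\<close>

text \<open>
  A super vector space is given by its homogeneous components \<open>V 0\<close> (even) and \<open>V 1\<close> (odd) inside
  some ambient vector space; the degrees form the two-element field \<^typ>\<open>bit\<close>. The space itself is
  the internal direct sum of the two components, not the ambient type.
\<close>

locale super_vector_space = vector_space scale
  for scale :: "'f::field \<Rightarrow> 'v::ab_group_add \<Rightarrow> 'v" (infixr "*s" 75) +
  fixes V :: "bit \<Rightarrow> 'v set"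
  assumes subspace_component: "subspace (V i)"
    and independent_components: "V 0 \<inter> V 1 = {0}"
begin

definition total :: "'v set" where
  "total = {x + y | x y. x \<in> V 0 \<and> y \<in> V 1}"

text \<open>
  A morphism out of a tensor power of the space is a multilinear map, and it is determined by its
  values on tensors of homogeneous elements. We therefore write it as a function of homogeneous
  elements paired with their degrees. The operations below are the precomposition
  with the braiding \<open>b : a \<otimes> b \<mapsto> (-1)^{|a||b|} b \<otimes> a\<close>, with \<open>b \<otimes> 1\<close> and with \<open>1 \<otimes> b\<close>.
\<close>

definition koszul :: "bit \<Rightarrow> bit \<Rightarrow> 'f" where
  "koszul i j = (if i = 1 \<and> j = 1 then - 1 else 1)"

definition comp_b :: "(bit \<times> 'v \<Rightarrow> bit \<times> 'v \<Rightarrow> 'v) \<Rightarrow> bit \<times> 'v \<Rightarrow> bit \<times> 'v \<Rightarrow> 'v" where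
  "comp_b f x y = koszul (fst x) (fst y) *s f y x"

definition comp_b_1 ::
  "(bit \<times> 'v \<Rightarrow> bit \<times> 'v \<Rightarrow> bit \<times> 'v \<Rightarrow> 'v) \<Rightarrow> bit \<times> 'v \<Rightarrow> bit \<times> 'v \<Rightarrow> bit \<times> 'v \<Rightarrow> 'v" where
  "comp_b_1 f x y z = koszul (fst x) (fst y) *s f y x z"

definition comp_1_b ::
  "(bit \<times> 'v \<Rightarrow> bit \<times> 'v \<Rightarrow> bit \<times> 'v \<Rightarrow> 'v) \<Rightarrow> bit \<times> 'v \<Rightarrow> bit \<times> 'v \<Rightarrow> bit \<times> 'v \<Rightarrow> 'v" where
  "comp_1_b f x y z = koszul (fst y) (fst z) *s f x z y"

definition homogeneous :: "(bit \<times> 'v) set" where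
  "homogeneous = {(i, x). x \<in> V i}"

definition on_pairs :: "('v \<Rightarrow> 'v \<Rightarrow> 'v) \<Rightarrow> bit \<times> 'v \<Rightarrow> bit \<times> 'v \<Rightarrow> 'v" where
  "on_pairs br x y = br (snd x) (snd y)"

definition nested ::
  "('v \<Rightarrow> 'v \<Rightarrow> 'v) \<Rightarrow> bit \<times> 'v \<Rightarrow> bit \<times> 'v \<Rightarrow> bit \<times> 'v \<Rightarrow> 'v" where
  "nested br x y z = br (snd x) (br (snd y) (snd z))"

end

text \<open>
  The assumptions \<open>add_left\<close> to \<open>degree\<close> say that the bracket is an (even) morphism
  \<open>L \<otimes> L \<rightarrow> L\<close>. In the Jacobi identity, \<open>comp_1_b (comp_b_1 f)\<close> is \<open>f \<circ> (b \<otimes> 1) \<circ> (1 \<otimes> b)\<close> and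
  \<open>comp_b_1 (comp_1_b f)\<close> is \<open>f \<circ> (1 \<otimes> b) \<circ> (b \<otimes> 1)\<close>. There is deliberately no condition
  \<open>[x, [x, x]] = 0\<close> for odd \<open>x\<close>: in characteristic 3 it does not follow.
\<close>

locale operadic_Lie_superalgebra = super_vector_space scale V
  for scale :: "'f::field \<Rightarrow> 'v::ab_group_add \<Rightarrow> 'v" (infixr "*s" 75) and V :: "bit \<Rightarrow> 'v set" +
  fixes bracket :: "'v \<Rightarrow> 'v \<Rightarrow> 'v"
  assumes add_left:
      "\<lbrakk>x \<in> total; x' \<in> total; y \<in> total\<rbrakk> \<Longrightarrow> bracket (x + x') y = bracket x y + bracket x' y"
    and add_right:
      "\<lbrakk>x \<in> total; y \<in> total; y' \<in> total\<rbrakk> \<Longrightarrow> bracket x (y + y') = bracket x y + bracket x y'"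
    and scale_left:
      "\<lbrakk>x \<in> total; y \<in> total\<rbrakk> \<Longrightarrow> bracket (a *s x) y = a *s bracket x y"
    and scale_right:
      "\<lbrakk>x \<in> total; y \<in> total\<rbrakk> \<Longrightarrow> bracket x (a *s y) = a *s bracket x y"
    and degree:
      "\<lbrakk>x \<in> V i; y \<in> V j\<rbrakk> \<Longrightarrow> bracket x y \<in> V (i + j)"
    and anticommutative:
      "\<lbrakk>p \<in> homogeneous; q \<in> homogeneous\<rbrakk>
        \<Longrightarrow> on_pairs bracket p q + comp_b (on_pairs bracket) p q = 0"
    and jacobi:
      "\<lbrakk>p \<in> homogeneous; q \<in> homogeneous; r \<in> homogeneous\<rbrakk>
        \<Longrightarrow> nested bracket p q r
          + comp_1_b (comp_b_1 (nested bracket)) p q r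
          + comp_b_1 (comp_1_b (nested bracket)) p q r = 0"


section \<open>\<open>J\<close>-ternary algebras\<close>

text \<open>
  The module \<open>M\<close> is the whole type \<^typ>\<open>'m\<close>, and \<open>t x y z\<close> is the product \<open>xyz\<close>; thus \<open>L\<^sub>x\<^sub>,\<^sub>y\<close> is
  \<open>t x y\<close>. Endomorphisms of \<open>M\<close> are elements of the function space \<^typ>\<open>'m \<Rightarrow> 'm\<close>, a vector space
  under pointwise operations. The product in \<open>End(M)\<close> is \<open>\<circ>\<close>, not the pointwise product
  that is also available on this type; note that \<open>\<circ>\<close> binds weaker than \<open>+\<close> and \<open>-\<close>.
\<close>

locale J_ternary_product = vector_space scale
  for scale :: "'f::field \<Rightarrow> 'm::ab_group_add \<Rightarrow> 'm" (infixr "*s" 75) +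
  fixes t :: "'m \<Rightarrow> 'm \<Rightarrow> 'm \<Rightarrow> 'm"
  assumes linear1: "Vector_Spaces.linear scale scale (\<lambda>x. t x y z)"
    and linear2: "Vector_Spaces.linear scale scale (\<lambda>y. t x y z)"
    and linear3: "Vector_Spaces.linear scale scale (\<lambda>z. t x y z)"
    and identity1:
      "t x y (t u v w) - t u v (t x y w) = t (t x y u) v w + t u (t y x v) w"
    and identity2:
      "t x y z - t z y x = t z x y - t x z y"
begin

definition scale_End :: "'f \<Rightarrow> ('m \<Rightarrow> 'm) \<Rightarrow> 'm \<Rightarrow> 'm" where
  "scale_End a g = (\<lambda>x. a *s g x)"

sublocale End: vector_space scale_End
  by unfold_locales
    (simp_all add: scale_End_def fun_eq_iff scale_right_distrib scale_left_distrib)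

definition ang :: "'m \<Rightarrow> 'm \<Rightarrow> 'm \<Rightarrow> 'm" where
  "ang x y = (\<lambda>z. t y z x - t x z y)"

definition J :: "('m \<Rightarrow> 'm) set" where
  "J = End.span {ang x y | x y. True}"

definition jordan :: "('m \<Rightarrow> 'm) \<Rightarrow> ('m \<Rightarrow> 'm) \<Rightarrow> 'm \<Rightarrow> 'm" where
  "jordan a b = scale_End (1 / 2) ((a \<circ> b) + (b \<circ> a))"

definition is_unit_J :: "('m \<Rightarrow> 'm) \<Rightarrow> bool" where
  "is_unit_J e \<longleftrightarrow> e \<in> J \<and> (\<forall>a\<in>J. jordan e a = a \<and> jordan a e = a)"

definition one_J :: "'m \<Rightarrow> 'm" where
  "one_J = (THE e. is_unit_J e)"

definition InStr :: "('m \<Rightarrow> 'm) set" where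
  "InStr = End.span {t x y | x y. True}"

text \<open>
  The action \<open>s \<cdot> j\<close> is the linear extension to \<open>J\<close> of
  \<open>s \<cdot> \<langle>a, b\<rangle> = \<langle>s a, b\<rangle> + \<langle>a, s b\<rangle>\<close>. That such an extension exists for \<open>s \<in> InStr\<close>
  is the lemma \<open>extends_action_exists\<close>; any two extensions agree on \<open>J\<close>, which is spanned by the \<open>\<langle>a, b\<rangle>\<close>.
\<close>

definition extends_action :: "('m \<Rightarrow> 'm) \<Rightarrow> (('m \<Rightarrow> 'm) \<Rightarrow> 'm \<Rightarrow> 'm) \<Rightarrow> bool" where
  "extends_action s T \<longleftrightarrow> Vector_Spaces.linear scale_End scale_End T \<and>
     (\<forall>a b. T (ang a b) = ang (s a) b + ang a (s b))"

definition act :: "('m \<Rightarrow> 'm) \<Rightarrow> ('m \<Rightarrow> 'm) \<Rightarrow> 'm \<Rightarrow> 'm" where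
  "act s j = (THE k. \<exists>T. extends_action s T \<and> T j = k)"

definition InDer :: "('m \<Rightarrow> 'm) set" where
  "InDer = {d \<in> InStr. act d one_J = 0}"

lemma t_simps:
  "t (x + x') y z = t x y z + t x' y z" "t x (y + y') z = t x y z + t x y' z"
  "t x y (z + z') = t x y z + t x y z'"
  "t (a *s x) y z = a *s t x y z" "t x (a *s y) z = a *s t x y z"
  "t x y (a *s z) = a *s t x y z"
  "t (x - x') y z = t x y z - t x' y z" "t x (y - y') z = t x y z - t x y' z"
  "t x y (z - z') = t x y z - t x y z'"
  "t 0 y z = 0" "t x 0 z = 0" "t x y 0 = 0"
proof -
  interpret l1: Vector_Spaces.linear scale scale "\<lambda>x. t x y z" for y z by (rule linear1)
  interpret l2: Vector_Spaces.linear scale scale "\<lambda>y. t x y z" for x z by (rule linear2)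
  interpret l3: Vector_Spaces.linear scale scale "\<lambda>z. t x y z" for x y by (rule linear3)
  show
    "t (x + x') y z = t x y z + t x' y z" "t x (y + y') z = t x y z + t x y' z"
    "t x y (z + z') = t x y z + t x y z'"
    "t (a *s x) y z = a *s t x y z" "t x (a *s y) z = a *s t x y z"
    "t x y (a *s z) = a *s t x y z"
    "t (x - x') y z = t x y z - t x' y z" "t x (y - y') z = t x y z - t x y' z"
    "t x y (z - z') = t x y z - t x y z'"
    "t 0 y z = 0" "t x 0 z = 0" "t x y 0 = 0"
    by (simp_all add: l1.add l2.add l3.add l1.scale l2.scale l3.scale
        l1.diff l2.diff l3.diff l1.zero l2.zero l3.zero)
qed

lemma ang_simps:
  "ang (x + x') y = ang x y + ang x' y" "ang x (y + y') = ang x y + ang x y'"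
  "ang (a *s x) y = scale_End a (ang x y)" "ang x (a *s y) = scale_End a (ang x y)"
  "ang 0 y = 0" "ang x 0 = 0"
  by (simp_all add: ang_def fun_eq_iff t_simps scale_End_def scale_right_diff_distrib)

lemma InStr_induct [consumes 1, case_names zero step]:
  assumes "s \<in> InStr" "P 0" "\<And>c x y s. s \<in> InStr \<Longrightarrow> P s \<Longrightarrow> P (scale_End c (t x y) + s)"
  shows "P s"
proof -
  have "s \<in> InStr \<and> P s"
    using assms(1) unfolding InStr_def
  proof (induction rule: End.span_induct_alt)
    case base
    show ?case using assms(2) by (metis End.span_zero)
  next
    case (step c g s)
    obtain x y where g: "g = t x y" using step(1) by auto
    have "scale_End c g + s \<in> InStr"
      unfolding InStr_def using step(1,2)
      by (intro End.span_add End.span_scale) (auto intro: End.span_base)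
    moreover have "s \<in> InStr" "P s" using step by (simp_all add: InStr_def)
    ultimately show ?case
      unfolding InStr_def[symmetric] g using assms(3)[of s c x y] by blast
  qed
  then show ?thesis ..
qed

lemma extends_action_exists:
  assumes "s \<in> InStr"
  shows "\<exists>T. extends_action s T"
  using assms
proof (induction rule: InStr_induct)
  case zero
  have "extends_action 0 (\<lambda>_. 0)"
    unfolding extends_action_def
    by (auto simp: ang_simps intro!: Vector_Spaces.linear.intro module_hom.intro
        module_hom_axioms.intro End.vector_space_axioms End.module_axioms)
  then show ?case by blast
next
  case (step c x y s)
  then obtain T where T: "extends_action s T" by blast
  interpret T: Vector_Spaces.linear scale_End scale_End T
    using T by (simp add: extends_action_def)
  define T' where "T' j = scale_End c ((t x y \<circ> j) - (j \<circ> t y x)) + T j" for j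
  have *: "t x y (t u v w) = t u v (t x y w) + t (t x y u) v w + t u (t y x v) w" for u v w
    using identity1[of x y u v w] by (simp add: algebra_simps)
  have **: "(t x y \<circ> ang a b) - (ang a b \<circ> t y x) = ang (t x y a) b + ang a (t x y b)" for a b
    by (rule ext) (simp add: ang_def t_simps *[of b _ a] *[of a _ b])
  have lin: "Vector_Spaces.linear scale_End scale_End T'"
  proof
    show "T' (f + g) = T' f + T' g" for f g
      by (auto simp: T'_def T.add fun_eq_iff scale_End_def t_simps scale_right_distrib
          scale_right_diff_distrib)
    show "T' (scale_End a f) = scale_End a (T' f)" for a f
      unfolding T'_def T.scale
      by (auto simp: fun_eq_iff scale_End_def t_simps scale_right_distrib
          scale_right_diff_distrib mult.commute)
  qed
  have "T' (ang a b) = ang ((scale_End c (t x y) + s) a) b + ang a ((scale_End c (t x y) + s) b)"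
    for a b
  proof -
    have "T' (ang a b) = scale_End c (ang (t x y a) b + ang a (t x y b)) + (ang (s a) b + ang a (s b))"
      using T unfolding T'_def ** extends_action_def by simp
    also have "\<dots> = ang ((scale_End c (t x y) + s) a) b + ang a ((scale_End c (t x y) + s) b)"
      by (simp add: ang_simps scale_End_def[of c "t x y"] End.scale_right_distrib)
    finally show ?thesis .
  qed
  with lin show ?case unfolding extends_action_def by blast
qed

lemma extends_action_unique:
  assumes "extends_action s T" "extends_action s T'" "j \<in> J"
  shows "T j = T' j"
proof -
  interpret p: vector_space_pair scale_End scale_End
    by unfold_locales
  show ?thesis
  proof (rule p.linear_eq_on_span[where f = T and g = T' and x = j])
    show "Vector_Spaces.linear scale_End scale_End T" "Vector_Spaces.linear scale_End scale_End T'"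
      using assms by (simp_all add: extends_action_def)
    show "j \<in> End.span {ang x y | x y. True}" using assms by (simp add: J_def)
    show "T g = T' g" if "g \<in> {ang x y | x y. True}" for g
      using that assms unfolding extends_action_def by force
  qed
qed

lemma act_eq: "extends_action s T \<Longrightarrow> j \<in> J \<Longrightarrow> act s j = T j"
  unfolding act_def by (rule the_equality) (auto dest: extends_action_unique)

lemma act_ang:
  assumes "s \<in> InStr"
  shows "act s (ang a b) = ang (s a) b + ang a (s b)"
proof -
  obtain T where T: "extends_action s T" using extends_action_exists assms by blast
  have "ang a b \<in> J" unfolding J_def by (auto intro: End.span_base)
  with T show ?thesis unfolding extends_action_def by (metis act_eq T)
qed

lemma act_linear:
  assumes "s \<in> InStr" "i \<in> J" "j \<in> J"
  shows "act s (i + j) = act s i + act s j" "act s (scale_End a i) = scale_End a (act s i)"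
proof -
  obtain T where T: "extends_action s T" using extends_action_exists assms by blast
  interpret T: Vector_Spaces.linear scale_End scale_End T
    using T by (simp add: extends_action_def)
  have "i + j \<in> J" "scale_End a i \<in> J"
    using assms unfolding J_def by (auto intro: End.span_add End.span_scale)
  with T assms show "act s (i + j) = act s i + act s j"
    and "act s (scale_End a i) = scale_End a (act s i)"
    by (metis act_eq T.add, metis act_eq T.scale)
qed

lemma is_unit_J_unique: "is_unit_J e \<Longrightarrow> is_unit_J e' \<Longrightarrow> e = e'"
  unfolding is_unit_J_def by metis

lemma J_linear:
  assumes "j \<in> J"
  shows "Vector_Spaces.linear scale scale j"
proof
  show "j (x + y) = j x + j y" "j (a *s x) = a *s j x" for x y a
    using assms unfolding J_def
    by (induction rule: End.span_induct_alt)
      (auto simp: scale_End_def ang_def t_simps algebra_simps)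
qed

lemma J_closed_tri:
  assumes "j \<in> J"
  shows "(t x y \<circ> j) - (j \<circ> t y x) \<in> J"
  using assms unfolding J_def
proof (induction rule: End.span_induct_alt)
  case base
  have "(t x y \<circ> 0) - (0 \<circ> t y x) = 0"
    by (rule ext) (simp add: t_simps)
  then show ?case by (simp only: End.span_zero)
next
  case (step c g j)
  obtain a b where g: "g = ang a b" using step(1) by auto
  have *: "t x y (t u v w) = t u v (t x y w) + t (t x y u) v w + t u (t y x v) w" for u v w
    using identity1[of x y u v w] by (simp add: algebra_simps)
  have "(t x y \<circ> (scale_End c g + j)) - ((scale_End c g + j) \<circ> t y x)
      = scale_End c (ang (t x y a) b + ang a (t x y b)) + ((t x y \<circ> j) - (j \<circ> t y x))"
    by (rule ext) (simp add: g scale_End_def ang_def t_simps *[of b _ a] *[of a _ b]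
        scale_right_distrib scale_right_diff_distrib)
  also have "\<dots> \<in> End.span {ang x y | x y. True}"
    by (rule End.span_add[OF End.span_scale[OF End.span_add] step(2)])
      (auto intro: End.span_base)
  finally show ?case .
qed

lemma jordan_closed:
  assumes "a \<in> J" "b \<in> J"
  shows "jordan a b \<in> J"
proof -
  have "(a \<circ> b) + (b \<circ> a) \<in> J"
    using assms(1) unfolding J_def
  proof (induction rule: End.span_induct_alt)
    case base
    have "(0 \<circ> b) + (b \<circ> 0) = 0"
      using J_linear[OF assms(2)] by (intro ext) (simp add: Vector_Spaces.linear_iff_module_hom module_hom.zero)
    then show ?case by (simp only: End.span_zero)
  next
    case (step c g a)
    obtain x y where g: "g = ang x y" using step(1) by auto
    have g': "ang x y = t x y - t y x"
      by (rule ext) (simp add: ang_def identity2[of x _ y] identity2[of y _ x, symmetric]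
          algebra_simps)
    interpret b: Vector_Spaces.linear scale scale b
      by (rule J_linear[OF assms(2)])
    have "((scale_End c g + a) \<circ> b) + (b \<circ> (scale_End c g + a))
        = scale_End c (((t x y \<circ> b) - (b \<circ> t y x)) - ((t y x \<circ> b) - (b \<circ> t x y)))
          + ((a \<circ> b) + (b \<circ> a))"
      by (rule ext) (simp add: g g' scale_End_def b.add b.scale b.diff algebra_simps)
    also have "\<dots> \<in> End.span {ang x y | x y. True}"
      using assms(2) unfolding J_def
      by (intro End.span_add[OF End.span_scale[OF End.span_diff] step(2)]
          J_closed_tri[unfolded J_def])
    finally show ?case .
  qed
  then show ?thesis unfolding jordan_def J_def by (rule End.span_scale)
qed

end

text \<open>
  That \<open>J\<close> is closed under the Jordan product (\<open>jordan_closed\<close>) is automatic; that it is unital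
  is an assumption. The unit of \<open>J\<close> is only required to be a unit for the Jordan product, not to
  be the identity map of \<open>M\<close>.
\<close>

locale J_ternary_algebra = J_ternary_product scale t
  for scale :: "'f::field \<Rightarrow> 'm::ab_group_add \<Rightarrow> 'm" (infixr "*s" 75)
    and t :: "'m \<Rightarrow> 'm \<Rightarrow> 'm \<Rightarrow> 'm" +
  assumes unital: "\<exists>e. is_unit_J e"
begin

lemma is_unit_one_J: "is_unit_J one_J"
  unfolding one_J_def using unital is_unit_J_unique by (metis theI)

text \<open>
  The direct sum \<open>InDer \<oplus> M\<close>, inside the vector space of all pairs.
\<close>

definition scale_sum :: "'f \<Rightarrow> ('m \<Rightarrow> 'm) \<times> 'm \<Rightarrow> ('m \<Rightarrow> 'm) \<times> 'm" where
  "scale_sum a = (\<lambda>(c, m). (scale_End a c, a *s m))"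

definition component :: "bit \<Rightarrow> (('m \<Rightarrow> 'm) \<times> 'm) set" where
  "component i = (if i = 0 then InDer \<times> {0} else {0} \<times> UNIV)"

end

end

theory Submission
  imports Defs
begin

text \<open>
  The point on which everything turns is that \<open>InDer\<close>, defined by the vanishing of an action at the
  unit of \<open>J\<close>, consists of exactly those elements of \<open>InStr\<close> that are derivations of the triple
  product (\<open>InDer_eq_InStr_Int_derivations\<close>). The reason is as follows. By the first ternary
  identity every \<open>s \<in> InStr\<close> has a companion \<open>s'\<close>, obtained by exchanging the indices in each
  \<open>L\<^sub>x\<^sub>,\<^sub>y\<close>, such that \<open>s(uvw) = (su)vw + u(s'v)w + uv(sw)\<close>; and \<open>s\<close> acts on \<open>J\<close> by
  \<open>j \<mapsto> s j - j s'\<close>. By the second identity \<open>\<langle>x, y\<rangle> = L\<^sub>x\<^sub>,\<^sub>y - L\<^sub>y\<^sub>,\<^sub>x\<close>, so that \<open>s - s' \<in> J\<close>. The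
  unit \<open>e\<close> of the Jordan algebra \<open>J\<close> need not be the identity map of \<open>M\<close>, but away from characteristic
  2 it is a two-sided unit of \<open>J\<close> for composition. If \<open>s e = e s'\<close>, then
  \<open>s - s' = e (s - s') e = e s e - e s' e = e s' - s e = 0\<close>, so \<open>s\<close> is a derivation. Conversely, for a
  derivation \<open>s\<close> the element \<open>k = s e - e s\<close> of \<open>J\<close> satisfies \<open>k = e k = e s e - e s\<close> and
  \<open>k = k e = s e - e s e\<close>; adding these gives \<open>2k = k\<close>.

  With this description the axioms are direct. The bracket of two odd elements lies in \<open>InDer\<close>, since
  symmetrizing the first identity in \<open>x, y\<close> says that \<open>L\<^sub>x\<^sub>,\<^sub>y + L\<^sub>y\<^sub>,\<^sub>x\<close> is a derivation. In the Jacobi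
  identity, three even arguments give the identity for commutators, two even arguments say that the
  commutator acts on \<open>M\<close> as it should, and one even argument is the derivation property. For three
  odd arguments the identity asks that the six products of \<open>x, y, z\<close> in all orders sum to zero; the
  second ternary identity groups them into three pairs of equal sum, so the total is three times one
  of the pairs. This is the only place where characteristic 3 enters other than through \<open>2 \<noteq> 0\<close>.
\<close>

section \<open>Companions of elements of the inner structure algebra\<close>

context J_ternary_product
begin

lemma linear_simps:
  assumes "Vector_Spaces.linear scale scale s"
  shows "s (x + y) = s x + s y" "s (x - y) = s x - s y" "s (a *s x) = a *s s x" "s 0 = 0"
    "s (- x) = - s x"
proof -
  interpret s: Vector_Spaces.linear scale scale s by (rule assms)
  show "s (x + y) = s x + s y" "s (x - y) = s x - s y" "s (a *s x) = a *s s x" "s 0 = 0"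
    "s (- x) = - s x"
    by (rule s.add s.diff s.scale s.zero s.neg)+
qed

lemma t_neg: "t (- x) y z = - t x y z" "t x (- y) z = - t x y z"
  using t_simps(7)[of 0 x y z] t_simps(8)[of x 0 y z] by (simp_all add: t_simps)

lemma triple_in_InStr: "t x y \<in> InStr"
  unfolding InStr_def by (auto intro: End.span_base)

lemma subspace_InStr: "End.subspace InStr"
  unfolding InStr_def by (rule End.subspace_span)

lemma ang_in_J: "ang x y \<in> J"
  unfolding J_def by (auto intro: End.span_base)

lemma subspace_J: "End.subspace J"
  unfolding J_def by (rule End.subspace_span)

lemma J_induct [consumes 1, case_names zero step]:
  assumes "j \<in> J" "P 0"
    "\<And>c x y j. j \<in> J \<Longrightarrow> P j \<Longrightarrow> P (scale_End c (ang x y) + j)"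
  shows "P j"
proof -
  have "j \<in> J \<and> P j"
    using assms(1) unfolding J_def
  proof (induction rule: End.span_induct_alt)
    case base
    show ?case using assms(2) End.span_zero by blast
  next
    case (step c g j)
    then obtain x y where g: "g = ang x y" and j: "j \<in> J" "P j" by (auto simp: J_def)
    have "scale_End c g + j \<in> J"
      unfolding g by (intro End.subspace_add End.subspace_scale subspace_J ang_in_J j)
    then show ?case using assms(3)[OF j] unfolding g J_def by blast
  qed
  then show ?thesis ..
qed

lemma ang_eq_commutator: "ang x y = t x y - t y x"
  by (rule ext) (simp add: ang_def identity2[of x _ y] identity2[of y _ x, symmetric]
      algebra_simps)

lemma InStr_linear:
  assumes "s \<in> InStr"
  shows "Vector_Spaces.linear scale scale s"
  using assms
proof (induction rule: InStr_induct)
  case zero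
  show ?case by unfold_locales simp_all
next
  case (step c x y s)
  show ?case
    by unfold_locales
      (simp_all add: scale_End_def t_simps linear_simps[OF step(2)] algebra_simps)
qed

text \<open>
  The first identity provides the companion \<open>t y x\<close> of \<open>t x y\<close>; the difference of the two is
  \<open>\<langle>x, y\<rangle>\<close>, so it lies in \<open>J\<close>.
\<close>

lemma InStr_companion:
  assumes "s \<in> InStr"
  shows "\<exists>s'. s - s' \<in> J \<and>
    (\<forall>u v w. s (t u v w) = t (s u) v w + t u (s' v) w + t u v (s w))"
  using assms
proof (induction rule: InStr_induct)
  case zero
  have "(0 :: 'm \<Rightarrow> 'm) - 0 \<in> J"
    by (intro End.subspace_diff End.subspace_0 subspace_J)
  then show ?case
    by (intro exI[of _ 0] conjI allI) (assumption, simp add: t_simps)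
next
  case (step c x y s)
  then obtain s' where s': "s - s' \<in> J"
    "\<And>u v w. s (t u v w) = t (s u) v w + t u (s' v) w + t u v (s w)" by blast
  have *: "t x y (t u v w) = t u v (t x y w) + t (t x y u) v w + t u (t y x v) w" for u v w
    using identity1[of x y u v w] by (simp add: algebra_simps)
  have "(scale_End c (t x y) + s) - (scale_End c (t y x) + s')
      = scale_End c (ang x y) + (s - s')"
    by (rule ext) (simp add: ang_eq_commutator scale_End_def algebra_simps)
  also have "\<dots> \<in> J"
    using s'(1) by (intro End.subspace_add End.subspace_scale subspace_J ang_in_J)
  finally show ?case
    by (intro exI[of _ "scale_End c (t y x) + s'"] conjI allI)
      (assumption, simp add: s'(2) * t_simps scale_End_def algebra_simps)
qed

lemma act_zero:
  assumes "s \<in> InStr"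
  shows "act s 0 = 0"
  using act_linear(1)[OF assms End.subspace_0[OF subspace_J] End.subspace_0[OF subspace_J]]
  by (simp only: add_0_left add_cancel_right_right)

lemma act_scale_ang_add:
  assumes "s \<in> InStr" "j \<in> J"
  shows "act s (scale_End c (ang a b) + j) = scale_End c (ang (s a) b + ang a (s b)) + act s j"
proof -
  have "scale_End c (ang a b) \<in> J"
    by (intro End.subspace_scale subspace_J ang_in_J)
  then show ?thesis
    by (simp only: act_linear[OF assms(1)] act_ang[OF assms(1)] assms(2) ang_in_J)
qed

text \<open>
  Expanding \<open>s\<close> of \<open>\<langle>a, b\<rangle> z = bza - azb\<close> moves \<open>s\<close> onto the outer factors and its companion onto
  \<open>z\<close>. This turns the abstractly defined action into a formula with compositions, which is what can
  be evaluated at the unit.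
\<close>

lemma act_eq_companion:
  assumes s: "s \<in> InStr"
    and s': "\<And>u v w. s (t u v w) = t (s u) v w + t u (s' v) w + t u v (s w)"
    and j: "j \<in> J"
  shows "act s j = (s \<circ> j) - (j \<circ> s')"
proof -
  note lin = linear_simps[OF InStr_linear[OF s]]
  show ?thesis
    using j
  proof (induction rule: J_induct)
    case zero
    have "(s \<circ> 0) - (0 \<circ> s') = 0" by (rule ext) (simp add: lin)
    with act_zero[OF s] show ?case by (rule trans[OF _ sym])
  next
    case (step c a b j)
    have "act s (scale_End c (ang a b) + j) = scale_End c (ang (s a) b + ang a (s b)) + act s j"
      by (rule act_scale_ang_add[OF s step(1)])
    also have "\<dots> = (s \<circ> (scale_End c (ang a b) + j)) - ((scale_End c (ang a b) + j) \<circ> s')"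
      by (rule ext) (simp add: step(2) scale_End_def ang_def lin s' t_simps algebra_simps)
    finally show ?case .
  qed
qed

lemma act_in_J:
  assumes s: "s \<in> InStr" and j: "j \<in> J"
  shows "act s j \<in> J"
  using j
proof (induction rule: J_induct)
  case zero
  show ?case unfolding act_zero[OF s] by (rule End.subspace_0[OF subspace_J])
next
  case (step c a b j)
  then show ?case
    unfolding act_scale_ang_add[OF s step(1)]
    by (intro End.subspace_add End.subspace_scale subspace_J ang_in_J)
qed

section \<open>Derivations of the triple product\<close>

definition derivations :: "('m \<Rightarrow> 'm) set" where
  "derivations = {d. Vector_Spaces.linear scale scale d \<and>
    (\<forall>u v w. d (t u v w) = t (d u) v w + t u (d v) w + t u v (d w))}"

lemma subspace_derivations: "End.subspace derivations"
  unfolding End.subspace_def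
proof (intro conjI ballI allI)
  have "Vector_Spaces.linear scale scale 0" by unfold_locales simp_all
  then show "0 \<in> derivations" by (simp add: derivations_def t_simps)
  fix c d a assume "c \<in> derivations"
  then have c: "Vector_Spaces.linear scale scale c"
    "\<And>u v w. c (t u v w) = t (c u) v w + t u (c v) w + t u v (c w)" by (auto simp: derivations_def)
  note c_simps = linear_simps[OF c(1)]
  have "Vector_Spaces.linear scale scale (scale_End a c)"
    by unfold_locales (simp_all add: scale_End_def c_simps algebra_simps)
  then show "scale_End a c \<in> derivations"
    by (simp add: derivations_def c(2) scale_End_def t_simps algebra_simps)
  assume "d \<in> derivations"
  then have d: "Vector_Spaces.linear scale scale d"
    "\<And>u v w. d (t u v w) = t (d u) v w + t u (d v) w + t u v (d w)" by (auto simp: derivations_def)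
  note d_simps = linear_simps[OF d(1)]
  have "Vector_Spaces.linear scale scale (c + d)"
    by unfold_locales (simp_all add: c_simps d_simps algebra_simps)
  then show "c + d \<in> derivations"
    by (simp add: derivations_def c(2) d(2) t_simps algebra_simps)
qed

text \<open>
  The companion of \<open>t x y + t y x\<close> is the same map again.
\<close>

lemma symmetrized_triple_in_derivations: "t x y + t y x \<in> derivations"
proof -
  have "t x y + t y x \<in> InStr"
    by (intro End.subspace_add subspace_InStr triple_in_InStr)
  moreover have "(t x y + t y x) (t u v w)
      = t ((t x y + t y x) u) v w + t u ((t x y + t y x) v) w + t u v ((t x y + t y x) w)"
    for u v w
    using identity1[of x y u v w] identity1[of y x u v w]
    by (simp add: t_simps algebra_simps)
  ultimately show ?thesis by (simp add: derivations_def InStr_linear)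
qed

lemma commutator_in_derivations:
  assumes "c \<in> derivations" "d \<in> derivations"
  shows "(c \<circ> d) - (d \<circ> c) \<in> derivations"
proof -
  have lin: "Vector_Spaces.linear scale scale c" "Vector_Spaces.linear scale scale d"
    and der: "\<And>u v w. c (t u v w) = t (c u) v w + t u (c v) w + t u v (c w)"
      "\<And>u v w. d (t u v w) = t (d u) v w + t u (d v) w + t u v (d w)"
    using assms by (auto simp: derivations_def)
  note simps = linear_simps[OF lin(1)] linear_simps[OF lin(2)]
  have "Vector_Spaces.linear scale scale ((c \<circ> d) - (d \<circ> c))"
    by unfold_locales (simp_all add: simps algebra_simps)
  then show ?thesis
    by (simp add: derivations_def der simps t_simps algebra_simps)
qed

text \<open>
  The commutator of \<open>s\<close>, with companion \<open>s'\<close>, and \<open>t x y\<close> is \<open>t (s x) y + t x (s' y)\<close>.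
\<close>

lemma commutator_in_InStr:
  assumes "s \<in> InStr" "s2 \<in> InStr"
  shows "(s \<circ> s2) - (s2 \<circ> s) \<in> InStr"
proof -
  obtain s' where s': "\<And>u v w. s (t u v w) = t (s u) v w + t u (s' v) w + t u v (s w)"
    using InStr_companion[OF assms(1)] by blast
  note lin = linear_simps[OF InStr_linear[OF assms(1)]]
  show ?thesis
    using assms(2)
  proof (induction rule: InStr_induct)
    case zero
    have "(s \<circ> 0) - (0 \<circ> s) = 0" by (rule ext) (simp add: lin)
    then show ?case by (simp only: End.subspace_0[OF subspace_InStr])
  next
    case (step c x y r)
    have "(s \<circ> (scale_End c (t x y) + r)) - ((scale_End c (t x y) + r) \<circ> s)
        = scale_End c (t (s x) y + t x (s' y)) + ((s \<circ> r) - (r \<circ> s))"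
      by (rule ext) (simp add: lin s' scale_End_def algebra_simps)
    also have "\<dots> \<in> InStr"
      using step(2)
      by (intro End.subspace_add End.subspace_scale subspace_InStr triple_in_InStr)
    finally show ?case .
  qed
qed

lemma add_self_cancel:
  fixes x y :: 'm
  assumes "(2::'f) \<noteq> 0" "x + x = y + y"
  shows "x = y"
proof -
  have "2 *s x = 2 *s y"
    using assms(2) scale_left_distrib[of 1 1] by simp
  then show ?thesis using assms(1) by simp
qed

end

section \<open>Inner derivations are the derivations in the inner structure algebra\<close>

context J_ternary_algebra
begin

lemma one_J_in_J: "one_J \<in> J"
  using is_unit_one_J by (simp add: is_unit_J_def)

text \<open>
  This is the Peirce argument for \<open>e a + a e = 2 a\<close> with \<open>e\<close> idempotent: multiplying by \<open>e\<close> on the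
  right gives \<open>e a e = a e\<close>, on the left \<open>e a e = e a\<close>, and hence \<open>e a = a e = a\<close>.
\<close>

lemma one_J_composition_unit:
  assumes two: "(2::'f) \<noteq> 0" and a: "a \<in> J"
  shows "one_J (a z) = a z" "a (one_J z) = a z"
proof -
  let ?e = "one_J"
  note e = linear_simps[OF J_linear[OF one_J_in_J]]
  have unit: "?e (b x) + b (?e x) = b x + b x" if b: "b \<in> J" for b x
  proof -
    have "jordan ?e b = b"
      using is_unit_one_J b unfolding is_unit_J_def by blast
    then have "(1 / 2) *s (?e (b x) + b (?e x)) = b x"
      unfolding jordan_def scale_End_def by (metis comp_apply plus_fun_apply)
    then have "2 *s ((1 / 2) *s (?e (b x) + b (?e x))) = 2 *s b x" by (rule arg_cong)
    moreover have "2 *s ((1 / 2) *s v) = v" for v :: 'm using two by simp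
    moreover have "2 *s v = v + v" for v :: 'm using scale_left_distrib[of 1 1 v] by simp
    ultimately show ?thesis by metis
  qed
  have idem: "?e (?e x) = ?e x" for x
    using unit[OF one_J_in_J] by (rule add_self_cancel[OF two])
  have "?e (a (?e z)) + a (?e z) = a (?e z) + a (?e z)"
    using unit[OF a, of "?e z"] by (simp only: idem)
  then have 1: "?e (a (?e z)) = a (?e z)" by simp
  have "?e (?e (a z)) + ?e (a (?e z)) = ?e (a z) + ?e (a z)"
    using arg_cong[OF unit[OF a, of z], of ?e] by (simp only: e)
  then have "?e (a z) + a (?e z) = ?e (a z) + ?e (a z)"
    by (simp only: idem 1)
  then have 2: "a (?e z) = ?e (a z)" by simp
  have "?e (a z) + ?e (a z) = a z + a z"
    using unit[OF a, of z] by (simp only: 2)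
  then show 3: "?e (a z) = a z" by (rule add_self_cancel[OF two])
  show "a (?e z) = a z" using 2 3 by (rule trans)
qed

text \<open>
  An element of \<open>InStr\<close> is a derivation once it equals its companion. The unit is compared with
  \<open>s - s'\<close> in one direction and with \<open>s e - e s\<close> in the other, both of which lie in \<open>J\<close>.
\<close>

lemma InDer_eq_InStr_Int_derivations:
  assumes two: "(2::'f) \<noteq> 0"
  shows "InDer = InStr \<inter> derivations"
proof (intro equalityI subsetI)
  let ?e = "one_J"
  note e = one_J_composition_unit[OF two]
  note e_add = linear_simps[OF J_linear[OF one_J_in_J]]
  {
    fix s assume "s \<in> InDer"
    then have s: "s \<in> InStr" and act: "act s ?e = 0" by (auto simp: InDer_def)
    obtain s' where J: "s - s' \<in> J"
      and s': "\<And>u v w. s (t u v w) = t (s u) v w + t u (s' v) w + t u v (s w)"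
      using InStr_companion[OF s] by blast
    have se: "s (?e x) = ?e (s' x)" for x
      using act unfolding act_eq_companion[OF s s' one_J_in_J]
      by (simp add: fun_eq_iff)
    have "s' x = s x" for x
    proof -
      have "s x - s' x = s (?e x) - s' (?e x)"
        using e(2)[OF J, of x] by simp
      also have "\<dots> = ?e (s (?e x)) - ?e (s' (?e x))"
        using e(1)[OF J, of "?e x"] by (simp add: e_add)
      also have "\<dots> = 0"
        using e(1)[OF one_J_in_J] by (simp add: se se[symmetric, of "?e x"])
      finally show ?thesis by simp
    qed
    then have "s' = s" ..
    with s' s show "s \<in> InStr \<inter> derivations" by (simp add: derivations_def InStr_linear)
  next
    fix s assume "s \<in> InStr \<inter> derivations"
    then have s: "s \<in> InStr"
      and der: "\<And>u v w. s (t u v w) = t (s u) v w + t u (s v) w + t u v (s w)"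
      by (auto simp: derivations_def)
    have act: "act s ?e = (s \<circ> ?e) - (?e \<circ> s)"
      by (rule act_eq_companion[OF s der one_J_in_J])
    then have J: "(s \<circ> ?e) - (?e \<circ> s) \<in> J"
      using act_in_J[OF s one_J_in_J] by simp
    have "s (?e x) - ?e (s x) = 0" for x
    proof -
      have "?e (s (?e x)) - ?e (s x) = s (?e x) - ?e (s x)"
        "s (?e x) - ?e (s (?e x)) = s (?e x) - ?e (s x)"
        using e[OF J, of x] e(1)[OF one_J_in_J] by (simp_all add: e_add)
      then show ?thesis by (simp add: algebra_simps)
    qed
    then have "act s ?e = 0" unfolding act by (simp add: fun_eq_iff)
    with s show "s \<in> InDer" by (simp add: InDer_def)
  }
qed

lemma subspace_InDer:
  assumes "(2::'f) \<noteq> 0"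
  shows "End.subspace InDer"
  unfolding InDer_eq_InStr_Int_derivations[OF assms]
  by (intro End.subspace_inter subspace_InStr subspace_derivations)

section \<open>The Lie superalgebra\<close>

text \<open>
  The second identity says that the sum of a product and the product with its last two factors
  exchanged does not change under cyclic rotation of the factors, so the sum consists of
  three equal parts.
\<close>

lemma sum_of_permuted_triples_eq_0:
  assumes "(3::'f) = 0"
  shows "t x y z + t y x z + (t z x y + t x z y) + (t y z x + t z y x) = 0"
proof -
  have "t x y z + t x z y = t z x y + t z y x"
    using identity2[of x y z] by (simp add: algebra_simps)
  moreover have "t y z x + t y x z = t x y z + t x z y"
    using identity2[of x z y] by (simp add: algebra_simps)
  moreover have "v + v + v = 0" for v :: 'm
  proof -
    have "v + v + v = (1 + 1 + 1) *s v" by (simp only: scale_left_distrib scale_one)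
    also have "(1 + 1 + 1 :: 'f) = 3" by simp
    finally show ?thesis using assms by simp
  qed
  ultimately have "(t x y z + t x z y) + (t x y z + t x z y) + (t x y z + t x z y) = 0"
    "t z x y + t z y x = t x y z + t x z y" "t y z x + t y x z = t x y z + t x z y"
    by simp_all
  then show ?thesis
    by (metis (no_types, lifting) add.assoc add.commute)
qed

abbreviation bracket :: "('m \<Rightarrow> 'm) \<times> 'm \<Rightarrow> ('m \<Rightarrow> 'm) \<times> 'm \<Rightarrow> ('m \<Rightarrow> 'm) \<times> 'm" where
  "bracket \<equiv> \<lambda>(c, m) (d, n). ((c \<circ> d) - (d \<circ> c) + t m n + t n m, c n - d m)"

lemma vector_space_sum: "vector_space scale_sum"
proof
  show "scale_sum a (x + y) = scale_sum a x + scale_sum a y"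
    "scale_sum (a + b) x = scale_sum a x + scale_sum b x"
    "scale_sum a (scale_sum b x) = scale_sum (a * b) x"
    "scale_sum 1 x = x" for a b x y
    by (cases x; cases y; simp add: scale_sum_def End.scale_right_distrib End.scale_left_distrib
        scale_right_distrib scale_left_distrib)+
qed

lemma super_vector_space_component:
  assumes "(2::'f) \<noteq> 0"
  shows "super_vector_space scale_sum component"
proof -
  interpret S: vector_space scale_sum by (rule vector_space_sum)
  note sub = subspace_InDer[OF assms]
  show ?thesis
  proof
    show "S.subspace (component i)" for i
    proof (cases "i = 0")
      case True
      then show ?thesis
        using End.subspace_0[OF sub] End.subspace_add[OF sub] End.subspace_scale[OF sub]
        by (auto simp: S.subspace_def component_def scale_sum_def zero_prod_def)
    next
      case False
      then show ?thesis
        by (auto simp: S.subspace_def component_def scale_sum_def zero_prod_def)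
    qed
    show "component 0 \<inter> component 1 = {0}"
      using End.subspace_0[OF sub] by (auto simp: component_def zero_prod_def)
  qed
qed

lemma operadic_Lie_superalgebra_bracket:
  assumes two: "(2::'f) \<noteq> 0" and three: "(3::'f) = 0"
  shows "operadic_Lie_superalgebra scale_sum component bracket"
proof -
  interpret S: super_vector_space scale_sum component
    by (rule super_vector_space_component[OF two])
  have total: "S.total = InDer \<times> UNIV"
    using End.subspace_0[OF subspace_InDer[OF two]] by (force simp: S.total_def component_def)
  have lin: "Vector_Spaces.linear scale scale c"
    and der: "\<And>u v w. c (t u v w) = t (c u) v w + t u (c v) w + t u v (c w)"
    if "c \<in> InDer" for c
    using that by (auto simp: InDer_eq_InStr_Int_derivations[OF two] derivations_def)
  show ?thesis
  proof
    fix x x' y y' :: "('m \<Rightarrow> 'm) \<times> 'm" and a :: 'f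
    assume "x \<in> S.total" and "y \<in> S.total"
    then obtain c m d n where x: "x = (c, m)" "c \<in> InDer" and y: "y = (d, n)" "d \<in> InDer"
      by (auto simp: total)
    obtain c' m' d' n' where x': "x' = (c', m')" and y': "y' = (d', n')"
      by (cases x', cases y')
    note c = linear_simps[OF lin[OF x(2)]] and d = linear_simps[OF lin[OF y(2)]]
    show "bracket (x + x') y = bracket x y + bracket x' y"
      by (simp add: x y x' fun_eq_iff d t_simps algebra_simps)
    show "bracket x (y + y') = bracket x y + bracket x y'"
      by (simp add: x y y' fun_eq_iff c t_simps algebra_simps)
    show "bracket (scale_sum a x) y = scale_sum a (bracket x y)"
      by (simp add: x y scale_sum_def scale_End_def fun_eq_iff d t_simps algebra_simps)
    show "bracket x (scale_sum a y) = scale_sum a (bracket x y)"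
      by (simp add: x y scale_sum_def scale_End_def fun_eq_iff c t_simps algebra_simps)
  next
    fix x y i j assume xy: "x \<in> component i" "y \<in> component j"
    obtain c m d n where eq: "x = (c, m)" "y = (d, n)" by (cases x, cases y)
    have zero: "0 \<in> InDer" by (rule End.subspace_0[OF subspace_InDer[OF two]])
    have sym: "t m n + t n m \<in> InDer"
      unfolding InDer_eq_InStr_Int_derivations[OF two]
      by (intro IntI symmetrized_triple_in_derivations End.subspace_add subspace_InStr triple_in_InStr)
    have comm: "(c \<circ> d) - (d \<circ> c) \<in> InDer" if "c \<in> InDer" "d \<in> InDer"
      using that unfolding InDer_eq_InStr_Int_derivations[OF two]
      by (intro IntI commutator_in_derivations commutator_in_InStr) auto
    note c0 = linear_simps(4)[OF lin, of c] and d0 = linear_simps(4)[OF lin, of d]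
    have c: "c \<in> InDer" and d: "d \<in> InDer"
      using xy zero by (auto simp: eq component_def split: if_splits)
    have zero_simps: "(c \<circ> 0) - (0 \<circ> c) = 0" "(0 \<circ> d) - (d \<circ> 0) = 0" "t v 0 = 0" "t 0 v = 0" for v
      by (rule ext, simp add: c0[OF c] d0[OF d] t_simps)+
    show "bracket x y \<in> component (i + j)"
      using xy sym comm[OF c d]
      by (cases i; cases j; clarsimp simp: eq component_def zero_simps c0[OF c] d0[OF d])
  next
    fix p q assume "p \<in> S.homogeneous" "q \<in> S.homogeneous"
    then show "S.on_pairs bracket p q + S.comp_b (S.on_pairs bracket) p q = 0"
      by (auto simp: S.homogeneous_def S.on_pairs_def S.comp_b_def S.koszul_def component_def
          scale_sum_def scale_End_def fun_eq_iff zero_prod_def lin linear_simps(4)[OF lin] t_simps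
          split: if_splits)
  next
    fix p q r assume hom: "p \<in> S.homogeneous" "q \<in> S.homogeneous" "r \<in> S.homogeneous"
    obtain i c x j d y k e z where eq: "p = (i, c, x)" "q = (j, d, y)" "r = (k, e, z)"
      by (metis prod_cases3)
    have c: "c \<in> InDer" and d: "d \<in> InDer" and e: "e \<in> InDer"
      using hom End.subspace_0[OF subspace_InDer[OF two]]
      by (auto simp: eq S.homogeneous_def component_def split: if_splits)
    \<comment> \<open>A homogeneous element has a zero entry, so each argument may be written as a pair with first
      entry in \<open>InDer\<close> whatever its degree; the linearity and derivation rules then hold
      for all three arguments at once, and the eight cases differ only in which entries vanish.\<close>
    have hom': "if i = 0 then x = 0 else c = 0" "if j = 0 then y = 0 else d = 0"
      "if k = 0 then z = 0 else e = 0"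
      using hom by (auto simp: eq S.homogeneous_def component_def split: if_splits)
    note simps = linear_simps[OF lin[OF c]] linear_simps[OF lin[OF d]] linear_simps[OF lin[OF e]]
      der[OF c] der[OF d] der[OF e]
    show "S.nested bracket p q r
          + S.comp_1_b (S.comp_b_1 (S.nested bracket)) p q r
          + S.comp_b_1 (S.comp_1_b (S.nested bracket)) p q r = 0"
      using hom' sum_of_permuted_triples_eq_0[OF three, of x y z]
      by (cases i; cases j; cases k)
        (simp_all add: eq S.nested_def S.comp_1_b_def S.comp_b_1_def S.koszul_def scale_sum_def
          scale_End_def fun_eq_iff zero_prod_def simps t_simps t_neg algebra_simps
          neg_eq_iff_add_eq_0)
  qed
qed

end

theorem lemma1p8:
  fixes scale :: "'f::field \<Rightarrow> 'm::ab_group_add \<Rightarrow> 'm"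
    and t :: "'m \<Rightarrow> 'm \<Rightarrow> 'm \<Rightarrow> 'm"
  assumes "CHAR('f) = 3"
    and "J_ternary_algebra scale t"
  shows "operadic_Lie_superalgebra
           (J_ternary_algebra.scale_sum scale)
           (J_ternary_algebra.component scale t)
           (\<lambda>(c, m) (d, n). ((c \<circ> d) - (d \<circ> c) + t m n + t n m, c n - d m))"
proof -
  interpret J_ternary_algebra scale t by (rule assms(2))
  have "\<not> CHAR('f) dvd 2" "CHAR('f) dvd 3" using assms(1) by simp_all
  then have "(2::'f) \<noteq> 0" "(3::'f) = 0"
    using of_nat_eq_0_iff_char_dvd[of 2, where 'a = 'f] of_nat_eq_0_iff_char_dvd[of 3, where 'a = 'f]
    by simp_all
  then show ?thesis by (rule operadic_Lie_superalgebra_bracket)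
qed

end
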